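(* Let $X$ and $J$ be finite, let $f\in\mathcal L(X,J)$ be generative, and let $C$ be a cell of $\Omega(X,J)$ of finite fanout such that $f$ generates all the formulas held in common knowledge in $C$, i.e. $F(C)=\underline{Ck}(\{f\})$. Then there is no uniform bound on the size of the possibility sets in $C$; that is, there is no $n\in\mathbb N$ such that every possibility set contained in $C$ has at most $n$ elements.
   Context: Formulas. $X$ (primitive propositions) and $J$ (agents) are finite sets. $\mathcal L=\mathcal L(X,J)$ is the smallest set of formulas containing $X$ and closed under $g\mapsto\neg g$, $(g,h)\mapsto g\wedge h$, and $g\mapsto k_jg$ for $j\in J$; $g\vee h$ and $g\to h$ are the usual abbreviations ($g\to h$ is $\neg g\vee h$). The multi-agent S5 logic has the rules modus ponens and necessitation (if $g$ is a theorem so is $k_jg$) and as axioms all substitution instances of propositional theorems, $(k_jg\wedge k_j(g\to h))\to k_jh$, $k_jg\to g$, $k_jg\to k_jk_jg$, $\neg k_jg\to k_j\neg k_jg$. A set of formulas is consistent if no finite subset leads to a contradiction in this logic, and complete if for each formula $g$ it contains $g$ or $\neg g$. $\Omega=\Omega(X,J)$ is the set of all complete and consistent subsets of $\mathcal L$. A tautology is a formula belonging to every $z\in\Omega$. Partitions, cells, topology. For $j\in J$, $\mathcal Q^j$ is the partition of $\Omega$ in which $z,z'$ are equivalent iff $\{g: k_jg\in z\}=\{g:k_jg\in z'\}$. A possibility set is a member of some $\mathcal Q^j$. A cell is a member of the meet partition $\bigwedge_{j\in J}\mathcal Q^j$, i.e. a minimal non-empty $C\subseteq\Omega$ such that $P\in\mathcal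 Q^j$ and $P\cap C\neq\emptyset$ imply $P\subseteq C$, for all $j$. A cell has finite fanout if every possibility set contained in it is finite. The topology of $\Omega$ has as base the sets $\{z\in\Omega: g\in z\}$, $g\in\mathcal L$. Let $E^0g=g$, $E g=\bigwedge_{j\in J}k_jg$, $E^{n}g=E(E^{n-1}g)$, and $\mathbf{Ck}(\{f\})=\{z\in\Omega: E^nf\in z\text{ for all }n\ge 0\}$. A cell $C$ is dense in $\mathbf{Ck}(\{f\})$ if $C\subseteq \mathbf{Ck}(\{f\})$ and $C$ is dense in it in the relative topology. For a cell $C$, $F(C)$ is the set of formulas $g$ held in common knowledge in $C$, i.e. with $E^ng\in z$ for all $n$ at any (equivalently every) $z\in C$; equivalently $F(C)=\{g: g\in z\text{ for all }z\in C\}$. $\underline{Ck}(\{f\})=\{g\in\mathcal L: \text{there is } i<\infty \text{ and a finite } T'\subseteq\{f\}\text{ with }(\bigwedge_{t\in T'}E^i t)\to g\text{ a tautology}\}$. Finite levels. Depth: $\mathrm{depth}(x)=0$ for $x\in X$, $\mathrm{depth}(\neg g)=\mathrm{depth}(g)$, $\mathrm{depth}(g\wedge h)=\max(\mathrm{depth}(g),\mathrm{depth}(h))$, $\mathrm{depth}(k_jg)=\mathrm{depth}(g)+1$. $\mathcal L_i$ is the set of formulas of depth $\le i$; $\Omega_i$ is the (finite) set of maximally consistent subsets of $\mathcal L_i$; $\pi_i:\Omega\to\Omega_i$, $\pi_i(z)=z\cap\mathcal L_i$ (surjective). $\mathcal G_i=\{\pi_i^{-1}(w):w\in\Omega_i\}$.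 For $i\ge1$, $\overline{\mathcal F}_i^j$ is the partition of $\Omega_i$ in which $w,w'$ are equivalent iff $\{g\in\mathcal L_{i-1}:k_jg\in w\}=\{g\in\mathcal L_{i-1}:k_jg\in w'\}$; $\overline{\mathcal F}_0^j=\{\Omega_0\}$; $\mathcal F_i^j=\{\pi_i^{-1}(B):B\in\overline{\mathcal F}_i^j\}$. For a formula $f$ of depth $d$, $\alpha^{\Omega_d}(f)=\{w\in\Omega_d:f\in w\}$. Generative formulas. For $i>0$ a non-empty $A\subseteq\Omega_i$ is semantically closed if for all $j\in J$, $B\in\mathcal G_{i-1}$, $w\in A$: if $\pi_i^{-1}(w)\subseteq F\in\mathcal F_i^j$ and $F\cap B\ne\emptyset$ then $F\cap B\cap\pi_i^{-1}(A)\neq\emptyset$. Every non-empty subset of $\Omega_0$ is semantically closed. A subset $A\subseteq\Omega_d$ is connected if any two of its elements are joined by a finite sequence in $A$ in which consecutive elements share a member of $\overline{\mathcal F}_d^j$ for some $j\in J$. A formula $f$ with $d=\mathrm{depth}(f)$ and $|J|\ge2$ is generative if $\alpha^{\Omega_d}(f)$ is semantically closed and connected, and there exists more than one cell dense in $\mathbf{Ck}(\{f\})$. *)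

theory Defs
  imports "HOL-Analysis.Analysis"
begin

text \<open>The finite sets \<open>X\<close> and \<open>J\<close> of primitive propositions and of agents are the
  type parameters \<open>'x\<close> and \<open>'j\<close>, which are of sort \<open>finite\<close> wherever finiteness matters.\<close>

datatype ('x, 'j) fm =
    Prop 'x
  | Neg "('x, 'j) fm"
  | Conj "('x, 'j) fm" "('x, 'j) fm"
  | K 'j "('x, 'j) fm"

definition Disj :: "('x, 'j) fm \<Rightarrow> ('x, 'j) fm \<Rightarrow> ('x, 'j) fm" where
  "Disj g h = Neg (Conj (Neg g) (Neg h))"

definition Imp :: "('x, 'j) fm \<Rightarrow> ('x, 'j) fm \<Rightarrow> ('x, 'j) fm" where
  "Imp g h = Disj (Neg g) h"

text \<open>The empty conjunction is a fixed propositional theorem of depth 0; \<open>undefined\<close>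
  is just an arbitrary primitive proposition.\<close>

definition Top :: "('x, 'j) fm" where
  "Top = Neg (Conj (Prop undefined) (Neg (Prop undefined)))"

fun conj_list :: "('x, 'j) fm list \<Rightarrow> ('x, 'j) fm" where
  "conj_list [] = Top"
| "conj_list [g] = g"
| "conj_list (g # h # gs) = Conj g (conj_list (h # gs))"

text \<open>The conjunction of a finite set of formulas, in an arbitrarily chosen order.
  It is meaningless for infinite sets.\<close>

definition big_conj :: "('x, 'j) fm set \<Rightarrow> ('x, 'j) fm" where
  "big_conj S = conj_list (SOME gs. distinct gs \<and> set gs = S)"

datatype pfm = PAtom nat | PNeg pfm | PConj pfm pfm

primrec peval :: "(nat \<Rightarrow> bool) \<Rightarrow> pfm \<Rightarrow> bool" where
  "peval v (PAtom n) = v n"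
| "peval v (PNeg p) = (\<not> peval v p)"
| "peval v (PConj p q) = (peval v p \<and> peval v q)"

primrec psubst :: "(nat \<Rightarrow> ('x, 'j) fm) \<Rightarrow> pfm \<Rightarrow> ('x, 'j) fm" where
  "psubst \<sigma> (PAtom n) = \<sigma> n"
| "psubst \<sigma> (PNeg p) = Neg (psubst \<sigma> p)"
| "psubst \<sigma> (PConj p q) = Conj (psubst \<sigma> p) (psubst \<sigma> q)"

inductive S5_theorem :: "('x, 'j) fm \<Rightarrow> bool" where
  prop_instance: "(\<And>v. peval v p) \<Longrightarrow> S5_theorem (psubst \<sigma> p)"
| ax_K: "S5_theorem (Imp (Conj (K j g) (K j (Imp g h))) (K j h))"
| ax_T: "S5_theorem (Imp (K j g) g)"
| ax_4: "S5_theorem (Imp (K j g) (K j (K j g)))"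
| ax_5: "S5_theorem (Imp (Neg (K j g)) (K j (Neg (K j g))))"
| modus_ponens: "S5_theorem g \<Longrightarrow> S5_theorem (Imp g h) \<Longrightarrow> S5_theorem h"
| necessitation: "S5_theorem g \<Longrightarrow> S5_theorem (K j g)"

text \<open>A finite set of premises is used only through its conjunction, so necessitation
  applies to theorems but not to premises.\<close>

definition leads_to_contradiction :: "('x, 'j) fm set \<Rightarrow> bool" where
  "leads_to_contradiction T \<longleftrightarrow> (\<exists>h. S5_theorem (Imp (big_conj T) (Conj h (Neg h))))"

definition consistent :: "('x, 'j) fm set \<Rightarrow> bool" where
  "consistent S \<longleftrightarrow> (\<forall>T. finite T \<and> T \<subseteq> S \<longrightarrow> \<not> leads_to_contradiction T)"

definition complete_fms :: "('x, 'j) fm set \<Rightarrow> bool" where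
  "complete_fms S \<longleftrightarrow> (\<forall>g. g \<in> S \<or> Neg g \<in> S)"

definition Omega :: "('x, 'j) fm set set" where
  "Omega = {z. complete_fms z \<and> consistent z}"

definition tautology :: "('x, 'j) fm \<Rightarrow> bool" where
  "tautology g \<longleftrightarrow> (\<forall>z\<in>Omega. g \<in> z)"

definition Q :: "'j \<Rightarrow> ('x, 'j) fm set set set" where
  "Q j = Omega // {(z, z'). z \<in> Omega \<and> z' \<in> Omega \<and> {g. K j g \<in> z} = {g. K j g \<in> z'}}"

definition possibility_set :: "('x, 'j) fm set set \<Rightarrow> bool" where
  "possibility_set P \<longleftrightarrow> (\<exists>j. P \<in> Q j)"

definition Q_closed :: "('x, 'j) fm set set \<Rightarrow> bool" where
  "Q_closed C \<longleftrightarrow> (\<forall>j. \<forall>P\<in>Q j. P \<inter> C \<noteq> {} \<longrightarrow> P \<subseteq> C)"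

definition cell :: "('x, 'j) fm set set \<Rightarrow> bool" where
  "cell C \<longleftrightarrow> C \<noteq> {} \<and> C \<subseteq> Omega \<and> Q_closed C \<and>
     (\<forall>D. D \<noteq> {} \<and> D \<subseteq> C \<and> Q_closed D \<longrightarrow> D = C)"

definition finite_fanout :: "('x, 'j) fm set set \<Rightarrow> bool" where
  "finite_fanout C \<longleftrightarrow> (\<forall>P. possibility_set P \<and> P \<subseteq> C \<longrightarrow> finite P)"

text \<open>The generating family is closed under binary intersections (take conjunctions of
  formulas) and covers \<open>Omega\<close>, so it is a base of the topology it generates.\<close>

definition Omega_top :: "('x, 'j) fm set topology" where
  "Omega_top = topology_generated_by (range (\<lambda>g. {z \<in> Omega. g \<in> z}))"

definition E :: "('x, 'j::finite) fm \<Rightarrow> ('x, 'j) fm" where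
  "E g = big_conj (range (\<lambda>j. K j g))"

definition Ck_set :: "('x, 'j::finite) fm set \<Rightarrow> ('x, 'j) fm set set" where
  "Ck_set T = {z \<in> Omega. \<forall>t\<in>T. \<forall>n. (E ^^ n) t \<in> z}"

definition Ck_fms :: "('x, 'j::finite) fm set \<Rightarrow> ('x, 'j) fm set" where
  "Ck_fms T = {g. \<exists>i T'. finite T' \<and> T' \<subseteq> T \<and> tautology (Imp (big_conj ((E ^^ i) ` T')) g)}"

definition dense_in_Ck :: "('x, 'j::finite) fm set set \<Rightarrow> ('x, 'j) fm set \<Rightarrow> bool" where
  "dense_in_Ck C T \<longleftrightarrow>
     C \<subseteq> Ck_set T \<and> subtopology Omega_top (Ck_set T) closure_of C = Ck_set T"

definition F :: "('x, 'j::finite) fm set set \<Rightarrow> ('x, 'j) fm set" where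
  "F C = {g. \<forall>z\<in>C. \<forall>n. (E ^^ n) g \<in> z}"

primrec depth :: "('x, 'j) fm \<Rightarrow> nat" where
  "depth (Prop x) = 0"
| "depth (Neg g) = depth g"
| "depth (Conj g h) = max (depth g) (depth h)"
| "depth (K j g) = depth g + 1"

definition L_level :: "nat \<Rightarrow> ('x, 'j) fm set" where
  "L_level i = {g. depth g \<le> i}"

definition Omega_level :: "nat \<Rightarrow> ('x, 'j) fm set set" where
  "Omega_level i = {w. w \<subseteq> L_level i \<and> consistent w \<and>
     (\<forall>w'. w \<subseteq> w' \<and> w' \<subseteq> L_level i \<and> consistent w' \<longrightarrow> w' = w)}"

definition pi_preimage :: "nat \<Rightarrow> ('x, 'j) fm set set \<Rightarrow> ('x, 'j) fm set set" where
  "pi_preimage i A = {z \<in> Omega. z \<inter> L_level i \<in> A}"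

definition G_level :: "nat \<Rightarrow> ('x, 'j) fm set set set" where
  "G_level i = (\<lambda>w. pi_preimage i {w}) ` Omega_level i"

definition F_bar :: "nat \<Rightarrow> 'j \<Rightarrow> ('x, 'j) fm set set set" where
  "F_bar i j = (if i = 0 then {Omega_level 0}
     else Omega_level i // {(w, w'). w \<in> Omega_level i \<and> w' \<in> Omega_level i \<and>
       {g \<in> L_level (i - 1). K j g \<in> w} = {g \<in> L_level (i - 1). K j g \<in> w'}})"

definition F_level :: "nat \<Rightarrow> 'j \<Rightarrow> ('x, 'j) fm set set set" where
  "F_level i j = pi_preimage i ` F_bar i j"

definition alpha :: "nat \<Rightarrow> ('x, 'j) fm \<Rightarrow> ('x, 'j) fm set set" where
  "alpha d f = {w \<in> Omega_level d. f \<in> w}"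

definition semantically_closed :: "nat \<Rightarrow> ('x, 'j) fm set set \<Rightarrow> bool" where
  "semantically_closed i A \<longleftrightarrow> A \<noteq> {} \<and> A \<subseteq> Omega_level i \<and>
     (i > 0 \<longrightarrow> (\<forall>j. \<forall>B\<in>G_level (i - 1). \<forall>w\<in>A. \<forall>D\<in>F_level i j.
        pi_preimage i {w} \<subseteq> D \<and> D \<inter> B \<noteq> {} \<longrightarrow> D \<inter> B \<inter> pi_preimage i A \<noteq> {}))"

definition connected_level :: "nat \<Rightarrow> ('x, 'j) fm set set \<Rightarrow> bool" where
  "connected_level d A \<longleftrightarrow> (\<forall>w\<in>A. \<forall>w'\<in>A.
     (w, w') \<in> {(u, v). u \<in> A \<and> v \<in> A \<and> (\<exists>j. \<exists>B\<in>F_bar d j. u \<in> B \<and> v \<in> B)}\<^sup>*)"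

definition generative :: "('x::finite, 'j::finite) fm \<Rightarrow> bool" where
  "generative f \<longleftrightarrow> CARD('j) \<ge> 2 \<and>
     semantically_closed (depth f) (alpha (depth f) f) \<and>
     connected_level (depth f) (alpha (depth f) f) \<and>
     (\<exists>C C'. C \<noteq> C' \<and> cell C \<and> cell C' \<and> dense_in_Ck C {f} \<and> dense_in_Ck C' {f})"

end

theory Submission
  imports Defs
begin

text \<open>Suppose all possibility sets in \<open>C\<close> have at most \<open>n\<close> elements. As \<open>C\<close> is dense in
  \<open>Ck_set {f}\<close>, and having more than \<open>n\<close> elements is an open property, the same bound holds
  throughout \<open>Ck_set {f}\<close>.

  Call \<open>z\<close> branching for agent \<open>j\<close> at level \<open>i\<close> if two of the level-\<open>i\<close> alternatives that \<open>j\<close> has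
  at \<open>z\<close> differ only in formulas of depth exactly \<open>i\<close>. If nothing branched at level \<open>depth f\<close>, a point of
  \<open>Ck_set {f}\<close> would be determined by its formulas of depth at most \<open>depth f\<close>, and connectedness
  would make every cell in \<open>Ck_set {f}\<close> meet every such class, so that there would be only
  one cell. Hence some point branches.

  If \<open>z\<close> branches for \<open>j\<close>, a Kripke model extends the level-\<open>i\<close> theory of \<open>z\<close> in two ways which
  another agent \<open>k\<close> cannot tell apart. This gives \<open>k\<close> one more alternative at level \<open>i + 1\<close>,
  loses none of \<open>j\<close>'s, and makes the extension branch for \<open>k\<close>. Alternating between \<open>j\<close> and \<open>k\<close>
  yields arbitrarily large possibility sets in \<open>Ck_set {f}\<close>.\<close>

section \<open>Propositional reasoning in S5\<close>

instance fm :: (countable, countable) countable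
  by countable_datatype

text \<open>Formulas \<open>K j g\<close> count as atoms, so truth under every \<open>v\<close>
  characterises the instances of propositional theorems.\<close>

primrec beval :: "(('x, 'j) fm \<Rightarrow> bool) \<Rightarrow> ('x, 'j) fm \<Rightarrow> bool" where
  "beval v (Prop x) = v (Prop x)"
| "beval v (Neg g) = (\<not> beval v g)"
| "beval v (Conj g h) = (beval v g \<and> beval v h)"
| "beval v (K j g) = v (K j g)"

lemma beval_Imp [simp]: "beval v (Imp g h) \<longleftrightarrow> (beval v g \<longrightarrow> beval v h)"
  by (simp add: Imp_def Disj_def)

lemma beval_Top [simp]: "beval v Top"
  by (simp add: Top_def)

lemma beval_conj_list [simp]: "beval v (conj_list gs) \<longleftrightarrow> (\<forall>g\<in>set gs. beval v g)"
  by (induction gs rule: conj_list.induct) auto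

lemma big_conj_list:
  assumes "finite T"
  obtains gs where "big_conj T = conj_list gs" "set gs = T"
proof -
  have "\<exists>gs. distinct gs \<and> set gs = T"
    using finite_distinct_list[OF assms] by blast
  from someI_ex[OF this] show ?thesis
    using that unfolding big_conj_def by blast
qed

lemma beval_big_conj [simp]: "finite T \<Longrightarrow> beval v (big_conj T) \<longleftrightarrow> (\<forall>g\<in>T. beval v g)"
  by (metis beval_conj_list big_conj_list)

lemma depth_conj_list: "\<forall>g\<in>set gs. depth g \<le> m \<Longrightarrow> depth (conj_list gs) \<le> m"
  by (induction gs rule: conj_list.induct) (auto simp: Top_def)

lemma depth_big_conj: "finite T \<Longrightarrow> \<forall>g\<in>T. depth g \<le> m \<Longrightarrow> depth (big_conj T) \<le> m"
  by (metis depth_conj_list big_conj_list)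

text \<open>Coding atoms by \<open>to_nat\<close> yields a propositional pattern that
  \<open>psubst from_nat\<close> turns back into the formula; this is where countability of the
  formulas enters.\<close>

primrec skeleton :: "('x::countable, 'j::countable) fm \<Rightarrow> pfm" where
  "skeleton (Prop x) = PAtom (to_nat (Prop x :: ('x, 'j) fm))"
| "skeleton (Neg g) = PNeg (skeleton g)"
| "skeleton (Conj g h) = PConj (skeleton g) (skeleton h)"
| "skeleton (K j g) = PAtom (to_nat (K j g))"

lemma psubst_skeleton:
  fixes g :: "('x::countable, 'j::countable) fm"
  shows "psubst from_nat (skeleton g) = g"
  by (induction g) auto

lemma peval_skeleton:
  "peval v (skeleton g) = beval (\<lambda>h :: ('x::countable, 'j::countable) fm. v (to_nat h)) g"
  by (induction g) auto

lemma beval_psubst: "beval v (psubst \<sigma> p) = peval (\<lambda>n. beval v (\<sigma> n)) p"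
  by (induction p) auto

lemma S5_prop:
  fixes g :: "('x::countable, 'j::countable) fm"
  assumes "\<And>v. beval v g"
  shows "S5_theorem g"
proof -
  have "S5_theorem (psubst (from_nat :: nat \<Rightarrow> ('x, 'j) fm) (skeleton g))"
    by (rule prop_instance) (simp add: peval_skeleton assms)
  then show ?thesis by (simp add: psubst_skeleton)
qed

lemma S5_conseq:
  fixes g :: "('x::countable, 'j::countable) fm"
  assumes "S5_theorem a" and "\<And>v. beval v a \<Longrightarrow> beval v g"
  shows "S5_theorem g"
  using assms(1) by (rule modus_ponens) (simp add: S5_prop assms(2))

lemma S5_conseq2:
  fixes g :: "('x::countable, 'j::countable) fm"
  assumes "S5_theorem a" and "S5_theorem b"
    and "\<And>v. beval v a \<Longrightarrow> beval v b \<Longrightarrow> beval v g"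
  shows "S5_theorem g"
  using assms(1)
  by (rule modus_ponens) (rule S5_conseq[OF assms(2)], use assms(3) in simp)

lemma leads_to_contradiction_iff:
  fixes T :: "('x::countable, 'j::countable) fm set"
  shows "leads_to_contradiction T \<longleftrightarrow> S5_theorem (Neg (big_conj T))"
  unfolding leads_to_contradiction_def
  by (meson S5_conseq beval.simps(2,3) beval_Imp)

lemma consistent_iff:
  fixes S :: "('x::countable, 'j::countable) fm set"
  shows "consistent S \<longleftrightarrow> (\<forall>T. finite T \<and> T \<subseteq> S \<longrightarrow> \<not> S5_theorem (Neg (big_conj T)))"
  by (simp add: consistent_def leads_to_contradiction_iff)

lemma consistent_subset: "consistent S \<Longrightarrow> R \<subseteq> S \<Longrightarrow> consistent R"
  unfolding consistent_def by blast


section \<open>Complete consistent sets\<close>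

lemma Omega_conseq:
  fixes z :: "('x::countable, 'j::countable) fm set"
  assumes "z \<in> Omega" "finite T" "T \<subseteq> z" "S5_theorem (Imp (big_conj T) g)"
  shows "g \<in> z"
proof (rule ccontr)
  assume "g \<notin> z"
  then have "Neg g \<in> z" using assms(1) unfolding Omega_def complete_fms_def by auto
  then have "finite (insert (Neg g) T)" "insert (Neg g) T \<subseteq> z" using assms by auto
  moreover have "S5_theorem (Neg (big_conj (insert (Neg g) T)))"
    by (rule S5_conseq[OF assms(4)]) (use assms(2) in auto)
  ultimately show False
    using assms(1) unfolding Omega_def mem_Collect_eq consistent_iff by blast
qed

lemma Omega_theorem:
  fixes z :: "('x::countable, 'j::countable) fm set"
  assumes "z \<in> Omega" "S5_theorem g"
  shows "g \<in> z"
  using Omega_conseq[of z "{}" g] S5_conseq[OF assms(2), of "Imp (big_conj {}) g"] assms(1)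
  by simp

lemma Omega_mp:
  fixes z :: "('x::countable, 'j::countable) fm set"
  assumes "z \<in> Omega" "S5_theorem (Imp g h)" "g \<in> z"
  shows "h \<in> z"
  using Omega_conseq[of z "{g}" h] S5_conseq[OF assms(2), of "Imp (big_conj {g}) h"] assms
  by simp

lemma Omega_Neg:
  fixes z :: "('x::countable, 'j::countable) fm set"
  assumes "z \<in> Omega"
  shows "Neg g \<in> z \<longleftrightarrow> g \<notin> z"
proof
  assume "Neg g \<in> z"
  show "g \<notin> z"
  proof
    assume "g \<in> z"
    have "S5_theorem (Neg (big_conj {g, Neg g}))" by (rule S5_prop) simp
    moreover have "finite {g, Neg g}" "{g, Neg g} \<subseteq> z" using \<open>g \<in> z\<close> \<open>Neg g \<in> z\<close> by auto
    ultimately show False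
      using assms unfolding Omega_def mem_Collect_eq consistent_iff by blast
  qed
next
  assume "g \<notin> z"
  then show "Neg g \<in> z" using assms unfolding Omega_def complete_fms_def by auto
qed

lemma Omega_Conj:
  fixes z :: "('x::countable, 'j::countable) fm set"
  assumes "z \<in> Omega"
  shows "Conj g h \<in> z \<longleftrightarrow> g \<in> z \<and> h \<in> z"
proof
  assume "Conj g h \<in> z"
  moreover have "S5_theorem (Imp (Conj g h) g)" "S5_theorem (Imp (Conj g h) h)"
    by (rule S5_prop; simp)+
  ultimately show "g \<in> z \<and> h \<in> z" using Omega_mp[OF assms] by blast
next
  assume "g \<in> z \<and> h \<in> z"
  then show "Conj g h \<in> z"
    by (intro Omega_conseq[OF assms, of "{g, h}"]) (auto intro!: S5_prop)
qed

lemma Omega_beval: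
  fixes z :: "('x::countable, 'j::countable) fm set"
  assumes "z \<in> Omega"
  shows "beval (\<lambda>h. h \<in> z) g \<longleftrightarrow> g \<in> z"
  by (induction g) (auto simp: Omega_Neg[OF assms] Omega_Conj[OF assms])

lemma Omega_big_conj:
  fixes z :: "('x::countable, 'j::countable) fm set"
  assumes "z \<in> Omega" "finite T"
  shows "big_conj T \<in> z \<longleftrightarrow> T \<subseteq> z"
  using beval_big_conj[OF assms(2), of "\<lambda>h. h \<in> z"] by (auto simp: Omega_beval[OF assms(1)])

lemma Omega_Imp:
  fixes z :: "('x::countable, 'j::countable) fm set"
  assumes "z \<in> Omega"
  shows "Imp g h \<in> z \<longleftrightarrow> (g \<in> z \<longrightarrow> h \<in> z)"
  using beval_Imp[of "\<lambda>h. h \<in> z"] by (simp add: Omega_beval[OF assms])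

lemma Omega_separate:
  fixes z y :: "('x::countable, 'j::countable) fm set"
  assumes "z \<in> Omega" "y \<in> Omega" "z \<noteq> y"
  shows "\<exists>g\<in>z. g \<notin> y"
  using assms Omega_Neg by blast

lemma lindenbaum:
  fixes S :: "('x::countable, 'j::countable) fm set"
  assumes "consistent S"
  obtains z where "z \<in> Omega" "S \<subseteq> z"
proof -
  define A where "A = {R. S \<subseteq> R \<and> consistent R}"
  have "\<exists>M\<in>A. \<forall>R\<in>A. M \<subseteq> R \<longrightarrow> R = M"
  proof (rule subset_Zorn_nonempty)
    show "A \<noteq> {}" using assms by (auto simp: A_def)
    fix c assume c: "c \<noteq> {}" "subset.chain A c"
    have "consistent (\<Union>c)"
      unfolding consistent_def
    proof (intro allI impI)
      fix T assume T: "finite T \<and> T \<subseteq> \<Union>c"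
      have "\<exists>R\<in>c. T \<subseteq> R"
      proof (cases "T = {}")
        case False
        show ?thesis
          using finite_subset_Union_chain[of T c A] T c by metis
      qed (use c in auto)
      then show "\<not> leads_to_contradiction T"
        using T c unfolding A_def consistent_def subset.chain_def by blast
    qed
    then show "\<Union>c \<in> A" using c unfolding A_def subset.chain_def by blast
  qed
  then obtain z where z: "z \<in> A" and max: "\<And>R. R \<in> A \<Longrightarrow> z \<subseteq> R \<Longrightarrow> R = z" by blast
  have con: "consistent z" using z by (simp add: A_def)
  \<comment> \<open>By maximality, a formula missing from \<open>z\<close> is refuted by a finite
    part of \<open>z\<close>. Two such parts, for \<open>g\<close> and for \<open>Neg g\<close>,
    would together be contradictory.\<close>
  have ins: "\<exists>T. finite T \<and> T \<subseteq> z \<and> S5_theorem (Imp (big_conj T) (Neg g))" if "g \<notin> z" for g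
  proof -
    have "insert g z \<notin> A" using that max by blast
    then have "\<not> consistent (insert g z)" using z by (auto simp: A_def)
    then obtain T where T: "finite T" "T \<subseteq> insert g z" "S5_theorem (Neg (big_conj T))"
      by (auto simp: consistent_iff)
    have "S5_theorem (Imp (big_conj (T - {g})) (Neg g))"
      by (rule S5_conseq[OF T(3)]) (use T(1) in auto)
    then show ?thesis using T by (intro exI[of _ "T - {g}"]) auto
  qed
  have "complete_fms z"
    unfolding complete_fms_def
  proof (rule allI, rule ccontr)
    fix g assume "\<not> (g \<in> z \<or> Neg g \<in> z)"
    then obtain T R where T: "finite T" "T \<subseteq> z" "S5_theorem (Imp (big_conj T) (Neg g))"
      and R: "finite R" "R \<subseteq> z" "S5_theorem (Imp (big_conj R) (Neg (Neg g)))"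
      using ins by meson
    have "S5_theorem (Neg (big_conj (T \<union> R)))"
      by (rule S5_conseq2[OF T(3) R(3)]) (use T(1) R(1) in auto)
    then show False
      using con T R unfolding consistent_iff by (meson finite_UnI le_sup_iff)
  qed
  then have "z \<in> Omega" using con by (simp add: Omega_def)
  then show thesis using that z by (auto simp: A_def)
qed

section \<open>Knowledge and the alternatives of an agent\<close>

definition knows :: "'j \<Rightarrow> ('x, 'j) fm set \<Rightarrow> ('x, 'j) fm set" where
  "knows j z = {g. K j g \<in> z}"

text \<open>\<open>below (Suc i) z\<close> is \<open>z \<inter> L_level i\<close>; the strict bound makes the missing level \<open>-1\<close>
  available as \<open>below 0\<close>, so that depth 0 needs no separate treatment.\<close>

definition below :: "nat \<Rightarrow> ('x, 'j) fm set \<Rightarrow> ('x, 'j) fm set" where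
  "below i z = {g \<in> z. depth g < i}"

lemma K_conseq:
  fixes z :: "('x::countable, 'j::countable) fm set"
  assumes "z \<in> Omega" "K j g \<in> z" "S5_theorem (Imp g h)"
  shows "K j h \<in> z"
proof -
  have "K j (Imp g h) \<in> z" using assms by (intro Omega_theorem necessitation)
  then have "Conj (K j g) (K j (Imp g h)) \<in> z" using assms by (simp add: Omega_Conj)
  then show ?thesis using Omega_mp[OF assms(1) ax_K] by blast
qed

lemma K_big_conj:
  fixes z :: "('x::countable, 'j::countable) fm set"
  assumes z: "z \<in> Omega" and "finite T" "T \<subseteq> knows j z"
  shows "K j (big_conj T) \<in> z"
proof -
  have Kconj: "K j (Conj g h) \<in> z" if "K j g \<in> z" "K j h \<in> z" for g h
  proof -
    have "S5_theorem (Imp g (Imp h (Conj g h)))" by (rule S5_prop) simp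
    then have "K j (Imp h (Conj g h)) \<in> z" using K_conseq z that by blast
    then have "Conj (K j h) (K j (Imp h (Conj g h))) \<in> z" using z that by (simp add: Omega_Conj)
    then show ?thesis using Omega_mp[OF z ax_K] by blast
  qed
  have "\<forall>g\<in>set gs. K j g \<in> z \<Longrightarrow> K j (conj_list gs) \<in> z" for gs
  proof (induction gs rule: conj_list.induct)
    case 1
    have "S5_theorem (K j Top :: ('x, 'j) fm)" by (intro necessitation S5_prop) simp
    then show ?case using z by (simp add: Omega_theorem)
  qed (auto intro: Kconj)
  then show ?thesis using assms by (metis big_conj_list in_mono knows_def mem_Collect_eq)
qed

lemma knows_subset:
  fixes z :: "('x::countable, 'j::countable) fm set"
  assumes "z \<in> Omega"
  shows "knows j z \<subseteq> z"
  using Omega_mp[OF assms ax_T] by (auto simp: knows_def)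

text \<open>Axioms 4 and 5 make an agent's knowledge and ignorance themselves known, so every
  complete consistent extension of \<open>knows j z\<close> has the same knowledge. As consistency
  is finitary, it suffices that \<open>j\<close> rules out no finite part of
  \<open>Y\<close>.\<close>

lemma accessible_extension:
  fixes z :: "('x::countable, 'j::countable) fm set"
  assumes z: "z \<in> Omega"
    and Y: "\<And>T. finite T \<Longrightarrow> T \<subseteq> Y \<Longrightarrow> K j (Neg (big_conj T)) \<notin> z"
  obtains y where "y \<in> Omega" "Y \<subseteq> y" "knows j y = knows j z"
proof -
  have "consistent (knows j z \<union> Y)"
    unfolding consistent_iff
  proof (intro allI impI notI)
    fix T assume T: "finite T \<and> T \<subseteq> knows j z \<union> Y" and S5: "S5_theorem (Neg (big_conj T))"
    let ?T1 = "T \<inter> knows j z" and ?T2 = "T - knows j z"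
    \<comment> \<open>If \<open>T\<close> is refutable, its part known at \<open>z\<close> refutes
      the rest, which lies in \<open>Y\<close>; so \<open>j\<close> would know that this rest
      fails.\<close>
    have "S5_theorem (Imp (big_conj ?T1) (Neg (big_conj ?T2)))"
      by (rule S5_conseq[OF S5]) (use T in auto)
    then have "K j (Neg (big_conj ?T2)) \<in> z"
      using T by (intro K_conseq[OF z K_big_conj[OF z]]) auto
    moreover have "K j (Neg (big_conj ?T2)) \<notin> z" using T by (intro Y) auto
    ultimately show False by blast
  qed
  then obtain y where y: "y \<in> Omega" "knows j z \<union> Y \<subseteq> y" by (rule lindenbaum)
  have "K j g \<in> y \<longleftrightarrow> K j g \<in> z" for g
  proof
    assume "K j g \<in> z"
    then have "K j (K j g) \<in> z" using Omega_mp[OF z ax_4] by blast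
    then show "K j g \<in> y" using y by (auto simp: knows_def)
  next
    assume "K j g \<in> y"
    show "K j g \<in> z"
    proof (rule ccontr)
      assume "K j g \<notin> z"
      then have "Neg (K j g) \<in> z" using Omega_Neg[OF z] by blast
      then have "K j (Neg (K j g)) \<in> z" using Omega_mp[OF z ax_5] by blast
      then have "Neg (K j g) \<in> y" using y by (auto simp: knows_def)
      then show False using \<open>K j g \<in> y\<close> Omega_Neg[OF y(1)] by blast
    qed
  qed
  then have "knows j y = knows j z" by (auto simp: knows_def)
  then show thesis using that y by blast
qed

lemma K_witness:
  fixes z :: "('x::countable, 'j::countable) fm set"
  assumes z: "z \<in> Omega" and "K j g \<notin> z"
  obtains y where "y \<in> Omega" "knows j y = knows j z" "g \<notin> y"
proof (rule accessible_extension[OF z, of "{Neg g}" j])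
  fix T assume T: "finite T" "T \<subseteq> {Neg g}"
  show "K j (Neg (big_conj T)) \<notin> z"
  proof
    assume "K j (Neg (big_conj T)) \<in> z"
    moreover have "S5_theorem (Imp (Neg (big_conj T)) g)"
      by (rule S5_prop) (use T in auto)
    ultimately show False using K_conseq[OF z] assms by blast
  qed
next
  fix y assume "y \<in> Omega" "{Neg g} \<subseteq> y" "knows j y = knows j z"
  then show thesis using that Omega_Neg by blast
qed

text \<open>A finite conjunction of formulas below depth \<open>i\<close> that is true at
  \<open>y\<close> is not ruled out by \<open>j\<close> at \<open>y\<close>. Its negation is still
  below depth \<open>i\<close>, so \<open>j\<close> does not rule it out at \<open>z\<close>
  either.\<close>

lemma below_lift:
  fixes z :: "('x::countable, 'j::countable) fm set"
  assumes z: "z \<in> Omega" and y: "y \<in> Omega" and eq: "below i (knows j z) = below i (knows j y)"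
  obtains y' where "y' \<in> Omega" "knows j y' = knows j z" "below i y' = below i y"
proof (cases i)
  \<comment> \<open>The empty conjunction has depth 0, which is not below \<open>i\<close> here; but
    \<open>below 0\<close> is empty, so \<open>z\<close> itself serves.\<close>
  case 0
  then show thesis using that[of z] z by (simp add: below_def)
next
  case (Suc m)
  show thesis
  proof (rule accessible_extension[OF z, of "below i y" j])
    fix T assume T: "finite T" "T \<subseteq> below i y"
    have "depth (big_conj T) \<le> m"
      using T Suc by (intro depth_big_conj) (auto simp: below_def less_Suc_eq_le)
    moreover have "Neg (big_conj T) \<notin> y"
      using T y by (auto simp: Omega_Neg Omega_big_conj below_def)
    then have "K j (Neg (big_conj T)) \<notin> y"
      using knows_subset[OF y] by (auto simp: knows_def)
    ultimately show "K j (Neg (big_conj T)) \<notin> z"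
      using eq[THEN eqset_imp_iff, of "Neg (big_conj T)"] Suc by (simp add: below_def knows_def)
  next
    fix y' assume y': "y' \<in> Omega" "below i y \<subseteq> y'" "knows j y' = knows j z"
    have "g \<in> y" if "g \<in> y'" "depth g < i" for g
    proof (rule ccontr)
      assume "g \<notin> y"
      then have "Neg g \<in> below i y" using that Omega_Neg[OF y] by (simp add: below_def)
      then show False using y' that Omega_Neg[OF y'(1)] by blast
    qed
    then have "below i y' = below i y" using y' by (auto simp: below_def)
    then show thesis using that y' by blast
  qed
qed

section \<open>Theories truncated at a depth\<close>

lemma below_knows_cong:
  "below (Suc i) z = below (Suc i) y \<Longrightarrow> below i (knows j z) = below i (knows j y)"
  by (force simp: below_def knows_def dest: eqset_imp_iff)

lemma below_below: "m \<le> i \<Longrightarrow> below m (below i z) = below m z"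
  by (auto simp: below_def)

lemma below_mono_eq: "m \<le> i \<Longrightarrow> below i z = below i y \<Longrightarrow> below m z = below m y"
  by (metis below_below)

lemma below_separate:
  fixes z y :: "('x::countable, 'j::countable) fm set"
  assumes "z \<in> Omega" "y \<in> Omega" "below i z \<noteq> below i y"
  shows "\<exists>g\<in>z. depth g < i \<and> g \<notin> y"
proof -
  obtain h where h: "depth h < i" "(h \<in> z) \<noteq> (h \<in> y)"
    using assms(3) by (auto simp: below_def)
  then show ?thesis
    using Omega_Neg[OF assms(1), of h] Omega_Neg[OF assms(2), of h]
    by (cases "h \<in> z") (auto intro: bexI[of _ "Neg h"])
qed

text \<open>Only finitely many truncations other than that of \<open>v\<close> occur in
  \<open>Y\<close>. Each is separated from \<open>v\<close> by a formula of \<open>v\<close>, and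
  the conjunction of these formulas still has depth at most \<open>i\<close>.\<close>

lemma below_isolate:
  fixes v :: "('x::countable, 'j::countable) fm set"
  assumes v: "v \<in> Omega" and Y: "Y \<subseteq> Omega" and fin: "finite (below (Suc i) ` Y)"
  shows "\<exists>g\<in>v. depth g \<le> i \<and> (\<forall>y\<in>Y. below (Suc i) y \<noteq> below (Suc i) v \<longrightarrow> g \<notin> y)"
proof -
  let ?N = "below (Suc i) ` Y - {below (Suc i) v}"
  have "\<forall>w\<in>?N. \<exists>g\<in>v. depth g \<le> i \<and> g \<notin> w"
  proof
    fix w assume "w \<in> ?N"
    then obtain y where "y \<in> Y" "w = below (Suc i) y" "below (Suc i) v \<noteq> below (Suc i) y" by auto
    then show "\<exists>g\<in>v. depth g \<le> i \<and> g \<notin> w"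
      using below_separate[OF v, of y "Suc i"] Y by (auto simp: below_def less_Suc_eq_le)
  qed
  then obtain g where g: "\<And>w. w \<in> ?N \<Longrightarrow> g w \<in> v \<and> depth (g w) \<le> i \<and> g w \<notin> w" by metis
  have fin': "finite (g ` ?N)" using fin by simp
  have "big_conj (g ` ?N) \<in> v" using g by (subst Omega_big_conj[OF v fin']) auto
  moreover have "depth (big_conj (g ` ?N)) \<le> i" using g by (intro depth_big_conj[OF fin']) auto
  moreover have "big_conj (g ` ?N) \<notin> y"
    if y: "y \<in> Y" "below (Suc i) y \<noteq> below (Suc i) v" for y
  proof -
    have w: "below (Suc i) y \<in> ?N" using y by auto
    have "g (below (Suc i) y) \<notin> y" using g[OF w] by (auto simp: below_def)
    then show ?thesis using w Y y Omega_big_conj[OF _ fin', of y] by blast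
  qed
  ultimately show ?thesis by blast
qed


section \<open>Kripke models\<close>

text \<open>Two worlds of \<open>W\<close> are indistinguishable for agent \<open>j\<close> iff \<open>\<kappa> j\<close> agrees on them; the
  valuation is read off from the propositions in \<open>p s\<close>.\<close>

primrec sat ::
  "'s set \<Rightarrow> ('j \<Rightarrow> 's \<Rightarrow> 'k) \<Rightarrow> ('s \<Rightarrow> ('x, 'j) fm set) \<Rightarrow> ('x, 'j) fm \<Rightarrow> 's \<Rightarrow> bool" where
  "sat W \<kappa> p (Prop x) s = (Prop x \<in> p s)"
| "sat W \<kappa> p (Neg g) s = (\<not> sat W \<kappa> p g s)"
| "sat W \<kappa> p (Conj g h) s = (sat W \<kappa> p g s \<and> sat W \<kappa> p h s)"
| "sat W \<kappa> p (K j g) s = (\<forall>t\<in>W. \<kappa> j t = \<kappa> j s \<longrightarrow> sat W \<kappa> p g t)"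

lemma sat_beval: "sat W \<kappa> p g s \<longleftrightarrow> beval (\<lambda>h. sat W \<kappa> p h s) g"
  by (induction g) auto

lemma sat_Imp [simp]: "sat W \<kappa> p (Imp g h) s \<longleftrightarrow> (sat W \<kappa> p g s \<longrightarrow> sat W \<kappa> p h s)"
  by (simp add: Imp_def Disj_def)

lemma sat_big_conj: "finite T \<Longrightarrow> sat W \<kappa> p (big_conj T) s \<longleftrightarrow> (\<forall>g\<in>T. sat W \<kappa> p g s)"
  using beval_big_conj[of T "\<lambda>h. sat W \<kappa> p h s"] by (simp flip: sat_beval)

text \<open>Having equal \<open>\<kappa> j\<close>-values is an equivalence relation, which
  validates the three axioms \<open>ax_T\<close>, \<open>ax_4\<close> and
  \<open>ax_5\<close>.\<close>

lemma soundness: "S5_theorem g \<Longrightarrow> s \<in> W \<Longrightarrow> sat W \<kappa> p g s"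
proof (induction arbitrary: s rule: S5_theorem.induct)
  case (prop_instance q \<sigma>)
  have "beval (\<lambda>h. sat W \<kappa> p h s) (psubst \<sigma> q)" using prop_instance by (simp add: beval_psubst)
  then show ?case by (simp flip: sat_beval)
qed auto

definition theory_of ::
  "'s set \<Rightarrow> ('j \<Rightarrow> 's \<Rightarrow> 'k) \<Rightarrow> ('s \<Rightarrow> ('x, 'j) fm set) \<Rightarrow> 's \<Rightarrow> ('x, 'j) fm set" where
  "theory_of W \<kappa> p s = {g. sat W \<kappa> p g s}"

lemma theory_of_Omega:
  fixes p :: "'s \<Rightarrow> ('x::countable, 'j::countable) fm set"
  assumes "s \<in> W"
  shows "theory_of W \<kappa> p s \<in> Omega"
proof -
  have "consistent (theory_of W \<kappa> p s)"
    unfolding consistent_iff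
  proof (intro allI impI notI)
    fix T assume T: "finite T \<and> T \<subseteq> theory_of W \<kappa> p s" and "S5_theorem (Neg (big_conj T))"
    from soundness[OF this(2) assms] have "sat W \<kappa> p (Neg (big_conj T)) s" .
    then show False using T by (auto simp: sat_big_conj theory_of_def)
  qed
  then show ?thesis by (simp add: Omega_def complete_fms_def theory_of_def)
qed

lemma knows_theory_of:
  "\<kappa> j s = \<kappa> j t \<Longrightarrow> knows j (theory_of W \<kappa> p s) = knows j (theory_of W \<kappa> p t)"
  by (simp add: knows_def theory_of_def)

section \<open>Points at which \<open>f\<close> is common knowledge\<close>

lemma Omega_E:
  fixes z :: "('x::finite, 'j::finite) fm set"
  assumes "z \<in> Omega"
  shows "E g \<in> z \<longleftrightarrow> (\<forall>j. K j g \<in> z)"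
  by (auto simp: E_def Omega_big_conj[OF assms])

lemma Ck_set_Omega: "z \<in> Ck_set T \<Longrightarrow> z \<in> Omega"
  by (simp add: Ck_set_def)

lemma Ck_set_mem: "z \<in> Ck_set {f} \<Longrightarrow> f \<in> z"
  unfolding Ck_set_def by (auto dest: spec[of _ 0])

lemma Ck_set_accessible:
  fixes z :: "('x::finite, 'j::finite) fm set"
  assumes z: "z \<in> Ck_set {f}" and y: "y \<in> Omega" "knows j y = knows j z"
  shows "y \<in> Ck_set {f}"
proof -
  have "(E ^^ n) f \<in> y" for n
  proof -
    have "E ((E ^^ n) f) \<in> z" using z unfolding Ck_set_def by (auto dest: spec[of _ "Suc n"])
    then have "K j ((E ^^ n) f) \<in> z" using Omega_E Ck_set_Omega[OF z] by blast
    then show ?thesis using knows_subset[OF y(1)] y(2) by (auto simp: knows_def)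
  qed
  then show ?thesis using y by (simp add: Ck_set_def)
qed

lemma theory_of_Ck_set:
  fixes p :: "'s \<Rightarrow> ('x::finite, 'j::finite) fm set"
  assumes f: "\<And>s. s \<in> W \<Longrightarrow> f \<in> theory_of W \<kappa> p s" and "s \<in> W"
  shows "theory_of W \<kappa> p s \<in> Ck_set {f}"
proof -
  have "sat W \<kappa> p ((E ^^ n) f) t" if "t \<in> W" for n t
    using that
  proof (induction n arbitrary: t)
    case 0
    then show ?case using f by (simp add: theory_of_def)
  next
    case (Suc n)
    then show ?case by (simp add: E_def sat_big_conj)
  qed
  then show ?thesis using assms theory_of_Omega by (auto simp: Ck_set_def theory_of_def)
qed

text \<open>These are the hypotheses of a truth lemma up to depth \<open>i\<close>:
  \<open>p_knows\<close> carries knowledge from a world to its alternatives, and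
  \<open>p_witness\<close> supplies a counterexample for what is not known. Both concern only
  formulas below depth \<open>i\<close>, because \<open>K j\<close> adds one to the depth.\<close>

locale faithful_model =
  fixes W :: "'s set" and \<kappa> :: "'j::finite \<Rightarrow> 's \<Rightarrow> 'k"
    and p :: "'s \<Rightarrow> ('x::finite, 'j) fm set" and i :: nat
  assumes p_Omega: "s \<in> W \<Longrightarrow> p s \<in> Omega"
    and p_knows: "s \<in> W \<Longrightarrow> t \<in> W \<Longrightarrow> \<kappa> j s = \<kappa> j t \<Longrightarrow>
      below i (knows j (p s)) = below i (knows j (p t))"
    and p_witness: "s \<in> W \<Longrightarrow> depth g < i \<Longrightarrow> K j g \<notin> p s \<Longrightarrow> \<exists>t\<in>W. \<kappa> j t = \<kappa> j s \<and> g \<notin> p t"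
begin

lemma sat_iff: "s \<in> W \<Longrightarrow> depth g \<le> i \<Longrightarrow> sat W \<kappa> p g s \<longleftrightarrow> g \<in> p s"
proof (induction g arbitrary: s)
  case (K j g)
  have "g \<in> p t" if "K j g \<in> p s" "t \<in> W" "\<kappa> j t = \<kappa> j s" for t
  proof -
    have "g \<in> below i (knows j (p s))" using that K.prems by (simp add: below_def knows_def)
    then have "g \<in> knows j (p t)"
      unfolding p_knows[OF that(2) K.prems(1) that(3), symmetric] by (simp add: below_def)
    then show ?thesis using knows_subset[OF p_Omega[OF that(2)]] by blast
  qed
  moreover have "\<exists>t\<in>W. \<kappa> j t = \<kappa> j s \<and> g \<notin> p t" if "K j g \<notin> p s"
    using p_witness[OF K.prems(1) _ that] K.prems(2) by simp
  moreover have "sat W \<kappa> p g t \<longleftrightarrow> g \<in> p t" if "t \<in> W" for t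
    using K.IH[OF that] K.prems(2) by simp
  ultimately show ?case by (metis sat.simps(4))
qed (auto simp: Omega_Neg Omega_Conj p_Omega)

lemma below_theory_of: "s \<in> W \<Longrightarrow> below (Suc i) (theory_of W \<kappa> p s) = below (Suc i) (p s)"
  by (auto simp: below_def theory_of_def sat_iff)

lemma theory_of_in_Ck_set:
  assumes "depth f \<le> i" "\<And>s. s \<in> W \<Longrightarrow> f \<in> p s" "s \<in> W"
  shows "theory_of W \<kappa> p s \<in> Ck_set {f}"
proof (rule theory_of_Ck_set[OF _ assms(3)])
  fix t assume "t \<in> W"
  then show "f \<in> theory_of W \<kappa> p t" using assms(1,2) by (simp add: theory_of_def sat_iff)
qed

end

text \<open>Coarsening indistinguishability to knowledge below depth \<open>i\<close> loses no
  alternative, and those it adds share that knowledge, so truth up to depth \<open>i\<close> is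
  preserved.\<close>

lemma faithful_Ck_set:
  fixes f :: "('x::finite, 'j::finite) fm"
  shows "faithful_model (Ck_set {f}) (\<lambda>j z. below i (knows j z)) (\<lambda>z. z) i"
proof
  fix z and g :: "('x, 'j) fm" and j
  assume z: "z \<in> Ck_set {f}" and g: "K j g \<notin> z"
  obtain y where y: "y \<in> Omega" "knows j y = knows j z" "g \<notin> y"
    using K_witness[OF Ck_set_Omega[OF z] g] .
  then show "\<exists>t\<in>Ck_set {f}. below i (knows j t) = below i (knows j z) \<and> g \<notin> t"
    using Ck_set_accessible[OF z] by metis
qed (simp_all add: Ck_set_Omega)


section \<open>Cells and density\<close>

lemma Q_class:
  assumes "z \<in> Omega"
  shows "{y \<in> Omega. knows j y = knows j z} \<in> Q j"
proof -
  let ?r = "{(z, z'). z \<in> Omega \<and> z' \<in> Omega \<and> {g. K j g \<in> z} = {g. K j g \<in> z'}}"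
  have "?r `` {z} \<in> Q j" unfolding Q_def using assms by (rule quotientI)
  moreover have "{y \<in> Omega. knows j y = knows j z} = ?r `` {z}" using assms by (auto simp: knows_def)
  ultimately show ?thesis by simp
qed

lemma Q_closedD: "Q_closed C \<Longrightarrow> P \<in> Q j \<Longrightarrow> z \<in> P \<Longrightarrow> z \<in> C \<Longrightarrow> P \<subseteq> C"
  by (auto simp: Q_closed_def)

lemma cell_accessible:
  assumes "cell C" "z \<in> C" "y \<in> Omega" "knows j y = knows j z"
  shows "y \<in> C"
proof -
  have z: "z \<in> Omega" and closed: "Q_closed C" using assms(1,2) by (auto simp: cell_def)
  have "{y \<in> Omega. knows j y = knows j z} \<subseteq> C"
    by (rule Q_closedD[OF closed Q_class[OF z] _ assms(2)]) (simp add: z)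
  then show ?thesis using assms(3,4) by blast
qed

text \<open>The intersection is closed again, so minimality identifies it with both cells.\<close>

lemma cells_meet_eq:
  assumes C: "cell C" and D: "cell D" and "z \<in> C" "z \<in> D"
  shows "C = D"
proof -
  have "Q_closed (C \<inter> D)"
    unfolding Q_closed_def
  proof (intro allI ballI impI)
    fix j P assume P: "P \<in> Q j" "P \<inter> (C \<inter> D) \<noteq> {}"
    then obtain y where "y \<in> P" "y \<in> C" "y \<in> D" by blast
    then show "P \<subseteq> C \<inter> D"
      using C D P(1) Q_closedD[of C P j y] Q_closedD[of D P j y] by (simp add: cell_def)
  qed
  moreover have "C \<inter> D \<noteq> {}" using assms by blast
  ultimately have "C \<inter> D = C" "C \<inter> D = D" using C D by (simp_all add: cell_def)
  then show ?thesis by simp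
qed

context
  fixes C :: "('x::finite, 'j::finite) fm set set" and f :: "('x, 'j) fm"
  assumes C: "cell C" and gen: "F C = Ck_fms {f}"
begin

text \<open>Otherwise \<open>Neg g\<close> would hold throughout \<open>C\<close> and hence be
  common knowledge there. Being generated by \<open>f\<close>, it would follow from formulas
  \<open>(E ^^ i) f\<close> that hold at \<open>z\<close>.\<close>

lemma generated_dense:
  assumes z: "z \<in> Ck_set {f}" and "g \<in> z"
  shows "\<exists>c\<in>C. g \<in> c"
proof (rule ccontr)
  assume no: "\<not> (\<exists>c\<in>C. g \<in> c)"
  have CO: "C \<subseteq> Omega" using C by (simp add: cell_def)
  have zO: "z \<in> Omega" using Ck_set_Omega z .
  have "(E ^^ n) (Neg g) \<in> c" if "c \<in> C" for n c
    using that
  proof (induction n arbitrary: c)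
    case 0
    then show ?case using no CO Omega_Neg by auto
  next
    case (Suc n)
    have cO: "c \<in> Omega" using Suc.prems CO by blast
    have "K j ((E ^^ n) (Neg g)) \<in> c" for j
    proof (rule ccontr)
      assume "K j ((E ^^ n) (Neg g)) \<notin> c"
      with cO obtain y where "y \<in> Omega" "knows j y = knows j c" "(E ^^ n) (Neg g) \<notin> y"
        by (rule K_witness)
      then show False using Suc cell_accessible[OF C Suc.prems] by blast
    qed
    then show ?case using Omega_E[OF cO] by simp
  qed
  then have "Neg g \<in> F C" by (simp add: F_def)
  then obtain i T where T: "finite T" "T \<subseteq> {f}" "tautology (Imp (big_conj ((E ^^ i) ` T)) (Neg g))"
    unfolding gen Ck_fms_def by blast
  have "(E ^^ i) ` T \<subseteq> z" using z T(2) by (auto simp: Ck_set_def)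
  then have "big_conj ((E ^^ i) ` T) \<in> z" using zO T(1) by (simp add: Omega_big_conj)
  then have "Neg g \<in> z" using T(3) zO by (simp add: tautology_def Omega_Imp)
  then show False using zO assms Omega_Neg by blast
qed

text \<open>Having more than \<open>n\<close> elements is an open property of possibility sets: disjoint
  neighbourhoods of the elements are described by formulas considered possible at \<open>z\<close>.\<close>

lemma possibility_bound_transfer:
  assumes bound: "\<And>P. possibility_set P \<Longrightarrow> P \<subseteq> C \<Longrightarrow> finite P \<and> card P \<le> n"
    and z: "z \<in> Ck_set {f}"
  shows "finite {y \<in> Omega. knows j y = knows j z} \<and> card {y \<in> Omega. knows j y = knows j z} \<le> n"
proof (rule finite_if_finite_subsets_card_bdd)
  \<comment> \<open>The possibility set is not known to be finite, so its finite subsets are bounded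
    instead.\<close>
  fix T assume sub: "T \<subseteq> {y \<in> Omega. knows j y = knows j z}" and fin: "finite T"
  have CO: "C \<subseteq> Omega" using C by (simp add: cell_def)
  have zO: "z \<in> Omega" using Ck_set_Omega z .
  have "\<forall>t\<in>T. \<forall>t'\<in>T - {t}. \<exists>g\<in>t. g \<notin> t'"
    using sub Omega_separate by blast
  then obtain s where s: "\<And>t t'. t \<in> T \<Longrightarrow> t' \<in> T \<Longrightarrow> t' \<noteq> t \<Longrightarrow> s t t' \<in> t \<and> s t t' \<notin> t'"
    by (metis DiffI singletonD)
  \<comment> \<open>For distinct \<open>t\<close> and \<open>t'\<close>, the formula
    \<open>s t t'\<close> belongs to \<open>A t\<close> and its negation to \<open>A t'\<close>, so
    no point satisfies both sets.\<close>
  define A where "A t = s t ` (T - {t}) \<union> (\<lambda>t'. Neg (s t' t)) ` (T - {t})" for t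
  have finA: "finite (A t)" for t using fin by (simp add: A_def)
  have AT: "big_conj (A t) \<in> t" if t: "t \<in> T" for t
  proof -
    have tO: "t \<in> Omega" using t sub by blast
    have "A t \<subseteq> t" using t s Omega_Neg[OF tO] by (auto simp: A_def)
    then show ?thesis using Omega_big_conj[OF tO finA] by blast
  qed
  \<comment> \<open>\<open>B\<close> says that \<open>j\<close> considers each \<open>A t\<close>
    possible; it holds at \<open>z\<close>, and density moves it to a point \<open>c\<close> of
    \<open>C\<close>.\<close>
  define B where "B = (\<lambda>t. Neg (K j (Neg (big_conj (A t))))) ` T"
  have finB: "finite B" using fin by (simp add: B_def)
  have "Neg (K j (Neg (big_conj (A t)))) \<in> z" if t: "t \<in> T" for t
  proof -
    have tO: "t \<in> Omega" "knows j t = knows j z" using t sub by blast+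
    have "Neg (big_conj (A t)) \<notin> t" using AT[OF t] Omega_Neg[OF tO(1)] by blast
    then have "Neg (big_conj (A t)) \<notin> knows j z" using knows_subset[OF tO(1)] tO(2) by blast
    then show ?thesis using Omega_Neg[OF zO] by (simp add: knows_def)
  qed
  then have "big_conj B \<in> z" using zO finB by (auto simp: Omega_big_conj B_def)
  then obtain c where c: "c \<in> C" "big_conj B \<in> c" using generated_dense[OF z] by blast
  have cO: "c \<in> Omega" using c CO by blast
  have "\<exists>y\<in>Omega. knows j y = knows j c \<and> A t \<subseteq> y" if t: "t \<in> T" for t
  proof -
    have "Neg (K j (Neg (big_conj (A t)))) \<in> c"
      using c(2) t Omega_big_conj[OF cO finB] unfolding B_def by blast
    then have "K j (Neg (big_conj (A t))) \<notin> c" using Omega_Neg[OF cO] by blast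
    with cO obtain y where y: "y \<in> Omega" "knows j y = knows j c" "Neg (big_conj (A t)) \<notin> y"
      by (rule K_witness)
    then have "A t \<subseteq> y" using Omega_Neg Omega_big_conj[OF y(1) finA] by blast
    then show ?thesis using y by blast
  qed
  then obtain m where m: "\<And>t. t \<in> T \<Longrightarrow> m t \<in> Omega \<and> knows j (m t) = knows j c \<and> A t \<subseteq> m t"
    by metis
  have "inj_on m T"
  proof (rule inj_onI, rule ccontr)
    fix t t' assume t: "t \<in> T" "t' \<in> T" "m t = m t'" "t \<noteq> t'"
    then have "s t t' \<in> A t" "Neg (s t t') \<in> A t'" by (auto simp: A_def)
    then show False using m t Omega_Neg by (metis subsetD)
  qed
  let ?P = "{y \<in> Omega. knows j y = knows j c}"
  have "possibility_set ?P" using Q_class[OF cO] unfolding possibility_set_def by (rule exI)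
  moreover have "?P \<subseteq> C" using cell_accessible[OF C c(1)] by blast
  ultimately have "finite ?P \<and> card ?P \<le> n" by (rule bound)
  moreover have "m ` T \<subseteq> ?P" using m by blast
  ultimately have "card (m ` T) \<le> n" by (meson card_mono le_trans)
  then show "card T \<le> n" using \<open>inj_on m T\<close> by (simp add: card_image)
qed

end


section \<open>Branching\<close>

text \<open>This is the part of a member of \<open>F_bar i j\<close> that is realised by points of
  \<open>Ck_set {f}\<close>.\<close>

definition level_class ::
  "('x::finite, 'j::finite) fm \<Rightarrow> nat \<Rightarrow> 'j \<Rightarrow> ('x, 'j) fm set \<Rightarrow> ('x, 'j) fm set set" where
  "level_class f i j z =
     below (Suc i) ` {y \<in> Ck_set {f}. below i (knows j y) = below i (knows j z)}"

definition branching ::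
  "('x::finite, 'j::finite) fm \<Rightarrow> nat \<Rightarrow> 'j \<Rightarrow> ('x, 'j) fm set \<Rightarrow> bool" where
  "branching f i j z \<longleftrightarrow> (\<exists>u\<in>Ck_set {f}. \<exists>v\<in>Ck_set {f}.
     below i (knows j u) = below i (knows j z) \<and> below i (knows j v) = below i (knows j z) \<and>
     below i u = below i v \<and> below (Suc i) u \<noteq> below (Suc i) v)"

text \<open>If agents distinguish points only by knowledge below depth \<open>i\<close>, the members
  of the level class become alternatives in a single possibility set of \<open>Omega\<close>. The
  truth lemma keeps their truncations, so the bound on possibility sets applies.\<close>

lemma level_class_bound:
  fixes f :: "('x::finite, 'j::finite) fm"
  assumes bound: "\<And>j z. z \<in> Ck_set {f} \<Longrightarrow> finite {y \<in> Omega. knows j y = knows j z} \<and>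
      card {y \<in> Omega. knows j y = knows j z} \<le> n"
    and d: "depth f \<le> i" and z: "z \<in> Ck_set {f}"
  shows "finite (level_class f i j z) \<and> card (level_class f i j z) \<le> n"
proof -
  let ?S = "Ck_set {f}" and ?\<kappa> = "\<lambda>j z. below i (knows j z)"
  interpret faithful_model ?S ?\<kappa> "\<lambda>z. z" i by (rule faithful_Ck_set)
  let ?th = "theory_of ?S ?\<kappa> (\<lambda>z. z)"
  have th: "?th y \<in> ?S" if "y \<in> ?S" for y
    using theory_of_in_Ck_set[OF d _ that] Ck_set_mem by blast
  let ?P = "{y \<in> Omega. knows j y = knows j (?th z)}"
  have "level_class f i j z \<subseteq> below (Suc i) ` ?P"
  proof
    fix w assume "w \<in> level_class f i j z"
    then obtain y where y: "y \<in> ?S" "?\<kappa> j y = ?\<kappa> j z" "w = below (Suc i) y"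
      by (auto simp: level_class_def)
    have "?th y \<in> ?P"
      using th[OF y(1)] Ck_set_Omega knows_theory_of[of ?\<kappa> j y z, OF y(2)] by blast
    then show "w \<in> below (Suc i) ` ?P" using below_theory_of[OF y(1)] y(3) by blast
  qed
  moreover have "finite ?P" "card ?P \<le> n" using bound th[OF z] by blast+
  ultimately show ?thesis
    by (meson card_image_le card_mono finite_imageI finite_subset le_trans)
qed

text \<open>Let \<open>v\<close> be a \<open>j\<close>-alternative which is dispensable at level \<open>i\<close>. Two worlds that look
  like \<open>z\<close> up to level \<open>i\<close>, one where \<open>j\<close> considers \<open>v\<close> possible and one where \<open>j\<close> does not,
  can be made indistinguishable for any agent \<open>k \<noteq> j\<close>. In the model below the worlds
  labelled \<open>True\<close> are those at which \<open>j\<close> excludes \<open>v\<close>.\<close>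

lemma branching_step:
  fixes f :: "('x::finite, 'j::finite) fm"
  assumes d: "depth f \<le> i" and z: "z \<in> Ck_set {f}" and br: "branching f i j z"
    and fin: "finite (level_class f i j z)" and kj: "k \<noteq> j"
    and fin': "\<And>l y. y \<in> Ck_set {f} \<Longrightarrow> finite (level_class f (Suc i) l y)"
  shows "\<exists>y\<in>Ck_set {f}. branching f (Suc i) k y \<and>
    card (level_class f i j z) \<le> card (level_class f (Suc i) j y) \<and>
    card (level_class f i k z) < card (level_class f (Suc i) k y)"
proof -
  let ?S = "Ck_set {f}"
  let ?N = "{y \<in> ?S. below i (knows j y) = below i (knows j z)}"
  \<comment> \<open>Of two branching points, \<open>z\<close> agrees up to depth \<open>i\<close>
    with at most one; another one is named \<open>v\<close>.\<close>
  obtain u v where uv: "u \<in> ?N" "v \<in> ?N" "below i u = below i v"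
      "below (Suc i) u \<noteq> below (Suc i) v" "below (Suc i) v \<noteq> below (Suc i) z"
    using br unfolding branching_def mem_Collect_eq by metis
  define M where "M = {y \<in> ?N. below (Suc i) y \<noteq> below (Suc i) v}"
  define W where "W = ?S \<times> {False} \<union> M \<times> {True}"
  \<comment> \<open>Only \<open>j\<close> reads the label, so every other agent confuses the two
    copies.\<close>
  define \<kappa> where "\<kappa> l s = (below i (knows l (fst s)), snd s \<and> l = j)"
    for l and s :: "('x, 'j) fm set \<times> bool"
  have WS: "fst s \<in> ?S" if "s \<in> W" for s using that by (auto simp: W_def M_def)
  interpret faithful_model W \<kappa> fst i
  proof
    fix s g l assume s: "s \<in> W" "depth g < i" "K l g \<notin> fst s"
    obtain y where y: "y \<in> Omega" "knows l y = knows l (fst s)" "g \<notin> y"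
      using K_witness[OF Ck_set_Omega[OF WS[OF s(1)]] s(3)] .
    have yS: "y \<in> ?S" using Ck_set_accessible[OF WS[OF s(1)] y(1,2)] .
    show "\<exists>t\<in>W. \<kappa> l t = \<kappa> l s \<and> g \<notin> fst t"
    proof (cases "snd s \<and> l = j")
      case False
      then show ?thesis using y yS by (intro bexI[of _ "(y, False)"]) (auto simp: W_def \<kappa>_def)
    next
      case True
      then have "below i (knows j (fst s)) = below i (knows j z)"
        using s(1) by (auto simp: W_def M_def)
      then have sz: "\<kappa> l s = \<kappa> l (t, True)" if "t \<in> ?N" for t
        using True that by (simp add: \<kappa>_def)
      have yN: "y \<in> ?N" using y yS True \<open>below i (knows j (fst s)) = _\<close> by simp
      show ?thesis
      proof (cases "y \<in> M")
        case True
        then show ?thesis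
          using y sz[OF yN] by (intro bexI[of _ "(y, True)"]) (auto simp: W_def)
      next
        \<comment> \<open>Here \<open>y\<close> was removed along with \<open>v\<close>. Its
          substitute \<open>u\<close> agrees with it below depth \<open>i\<close>, and
          \<open>g\<close> is below that depth.\<close>
        case False
        then have "below (Suc i) y = below (Suc i) v" using yN by (simp add: M_def)
        then have "below i y = below i u"
          using uv(3) below_mono_eq[of i "Suc i" y v] by simp
        then have "g \<notin> u" using y(3) s(2) by (auto simp: below_def)
        moreover have "u \<in> M" using uv by (simp add: M_def)
        ultimately show ?thesis
          using sz[OF uv(1)] by (intro bexI[of _ "(u, True)"]) (auto simp: W_def)
      qed
    qed
  qed (use WS Ck_set_Omega in \<open>auto simp: \<kappa>_def\<close>)
  let ?th = "theory_of W \<kappa> fst"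
  have th: "?th s \<in> ?S" if "s \<in> W" for s
    using theory_of_in_Ck_set[OF d _ that] WS Ck_set_mem by blast
  have zM: "(z, True) \<in> W" "(z, False) \<in> W" using z uv(5) by (auto simp: W_def M_def)
  let ?y = "?th (z, False)" and ?y' = "?th (z, True)"
  have yS: "?y \<in> ?S" "?y' \<in> ?S" using th zM by blast+
  have kn: "knows k ?y' = knows k ?y"
    by (rule knows_theory_of) (use kj in \<open>simp add: \<kappa>_def\<close>)
  have eq: "below (Suc i) ?y' = below (Suc i) ?y"
    using below_theory_of zM by simp
  \<comment> \<open>A formula \<open>g\<close> isolates \<open>v\<close> in the level class. Then
    \<open>j\<close> knows \<open>Neg g\<close> at \<open>?y'\<close> but not at \<open>?y\<close>,
    and \<open>K j (Neg g)\<close> has depth at most \<open>i + 1\<close>.\<close>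
  have ne: "below (Suc (Suc i)) ?y \<noteq> below (Suc (Suc i)) ?y'"
  proof -
    have "finite (below (Suc i) ` ?N)" using fin by (simp add: level_class_def)
    then obtain g where g: "g \<in> v" "depth g \<le> i" "\<And>y. y \<in> M \<Longrightarrow> g \<notin> y"
      using below_isolate[of v ?N i] uv(2) Ck_set_Omega unfolding M_def by blast
    have vW: "(v, False) \<in> W" "\<kappa> j (v, False) = \<kappa> j (z, False)"
      using uv(2) by (auto simp: W_def \<kappa>_def)
    have "K j (Neg g) \<notin> ?y"
      using vW g sat_iff[OF vW(1) g(2)] unfolding theory_of_def by auto
    moreover have "K j (Neg g) \<in> ?y'"
    proof -
      have "\<not> sat W \<kappa> fst g t" if t: "t \<in> W" "\<kappa> j t = \<kappa> j (z, True)" for t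
      proof -
        have "fst t \<in> M" using t by (auto simp: W_def \<kappa>_def)
        then show ?thesis using g(3) sat_iff[OF t(1) g(2)] by blast
      qed
      then show ?thesis by (simp add: theory_of_def)
    qed
    moreover have "depth (K j (Neg g)) < Suc (Suc i)" using g(2) by simp
    ultimately show ?thesis unfolding below_def by blast
  qed
  have br': "branching f (Suc i) k ?y"
    unfolding branching_def using yS kn eq ne by metis
  \<comment> \<open>The worlds labelled \<open>False\<close> retain every previous alternative of
    every agent.\<close>
  have sub: "level_class f i l z \<subseteq> below (Suc i) ` level_class f (Suc i) l ?y" for l
  proof
    fix w assume "w \<in> level_class f i l z"
    then obtain t where t: "t \<in> ?S" "below i (knows l t) = below i (knows l z)" "w = below (Suc i) t"
      by (auto simp: level_class_def)
    have tW: "(t, False) \<in> W" using t by (simp add: W_def)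
    have "knows l (?th (t, False)) = knows l ?y"
      by (rule knows_theory_of) (simp add: \<kappa>_def t)
    then have "below (Suc (Suc i)) (?th (t, False)) \<in> level_class f (Suc i) l ?y"
      using th[OF tW] by (auto simp: level_class_def)
    moreover have "w = below (Suc i) (below (Suc (Suc i)) (?th (t, False)))"
      using below_theory_of[OF tW] t(3) by (simp add: below_below)
    ultimately show "w \<in> below (Suc i) ` level_class f (Suc i) l ?y" by blast
  qed
  have le: "card (level_class f i l z) \<le> card (below (Suc i) ` level_class f (Suc i) l ?y)" for l
    using sub fin'[OF yS(1)] by (intro card_mono) auto
  have "card (below (Suc i) ` level_class f (Suc i) j ?y) \<le> card (level_class f (Suc i) j ?y)"
    using fin'[OF yS(1)] by (rule card_image_le)
  then have lej: "card (level_class f i j z) \<le> card (level_class f (Suc i) j ?y)"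
    using le[of j] by linarith
  \<comment> \<open>For \<open>k\<close>, both \<open>?y\<close> and \<open>?y'\<close> are
    alternatives; they coincide up to depth \<open>i\<close> but not up to \<open>i + 1\<close>,
    which makes the growth strict.\<close>
  have "\<not> inj_on (below (Suc i)) (level_class f (Suc i) k ?y)"
  proof -
    have "below (Suc (Suc i)) ?y \<in> level_class f (Suc i) k ?y"
      "below (Suc (Suc i)) ?y' \<in> level_class f (Suc i) k ?y"
      using yS kn by (auto simp: level_class_def)
    moreover have "below (Suc i) (below (Suc (Suc i)) ?y) = below (Suc i) (below (Suc (Suc i)) ?y')"
      using eq by (simp add: below_below)
    ultimately show ?thesis using ne by (meson inj_onD)
  qed
  then have "card (below (Suc i) ` level_class f (Suc i) k ?y) < card (level_class f (Suc i) k ?y)"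
    using fin'[OF yS(1)] by (meson card_image_le eq_card_imp_inj_on le_neq_implies_less)
  then have "card (level_class f i k z) < card (level_class f (Suc i) k ?y)"
    using le[of k] by linarith
  then show ?thesis using br' lej yS by blast
qed

text \<open>Each step swaps the roles of the agents: \<open>k\<close> gains an alternative and
  becomes the branching agent while \<open>j\<close> loses none, so the sum of both cardinalities
  grows.\<close>

lemma branching_unbounded:
  fixes f :: "('x::finite, 'j::finite) fm"
  assumes fin: "\<And>i j z. depth f \<le> i \<Longrightarrow> z \<in> Ck_set {f} \<Longrightarrow> finite (level_class f i j z)"
    and z: "z \<in> Ck_set {f}" and br: "branching f (depth f) j z" and kj: "k \<noteq> j"
  shows "\<exists>i\<ge>depth f. \<exists>z\<in>Ck_set {f}. \<exists>j k. k \<noteq> j \<and> branching f i j z \<and>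
    m \<le> card (level_class f i j z) + card (level_class f i k z)"
proof (induction m)
  case 0
  then show ?case using z br kj by blast
next
  case (Suc m)
  then obtain i z j k where i: "depth f \<le> i" and z: "z \<in> Ck_set {f}" and kj: "k \<noteq> j"
    and br: "branching f i j z"
    and m: "m \<le> card (level_class f i j z) + card (level_class f i k z)" by blast
  obtain y where "y \<in> Ck_set {f}" "branching f (Suc i) k y"
    "card (level_class f i j z) \<le> card (level_class f (Suc i) j y)"
    "card (level_class f i k z) < card (level_class f (Suc i) k y)"
    using branching_step[OF i z br fin[OF i z] kj] fin i by (metis le_SucI)
  moreover from this m
  have "Suc m \<le> card (level_class f (Suc i) k y) + card (level_class f (Suc i) j y)" by linarith
  ultimately show ?case using kj i by (metis le_SucI)
qed


section \<open>Generative formulas branch\<close>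

lemma Int_L_level: "z \<inter> L_level i = below (Suc i) z"
  by (auto simp: L_level_def below_def less_Suc_eq_le)

text \<open>A maximal set is the truncation of any of its completions. Conversely, truncations are
  maximal because negation preserves depth.\<close>

lemma Omega_level_eq:
  "Omega_level i = below (Suc i) ` (Omega :: ('x::countable, 'j::countable) fm set set)"
proof (intro equalityI subsetI)
  fix w :: "('x, 'j) fm set" assume "w \<in> Omega_level i"
  then have w: "w \<subseteq> L_level i" "consistent w"
    "\<And>w'. w \<subseteq> w' \<Longrightarrow> w' \<subseteq> L_level i \<Longrightarrow> consistent w' \<Longrightarrow> w' = w"
    by (auto simp: Omega_level_def)
  obtain z where z: "z \<in> Omega" "w \<subseteq> z" using lindenbaum[OF w(2)] .
  have "consistent (z \<inter> L_level i)"
    using z(1) by (auto simp: Omega_def intro: consistent_subset[of z])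
  then have "z \<inter> L_level i = w" using w z by (intro w(3)) auto
  then show "w \<in> below (Suc i) ` Omega" using z by (auto simp: Int_L_level)
next
  fix w :: "('x, 'j) fm set" assume "w \<in> below (Suc i) ` Omega"
  then obtain z where z: "z \<in> Omega" "w = z \<inter> L_level i" by (auto simp: Int_L_level)
  have "consistent w" using z by (auto simp: Omega_def intro: consistent_subset[of z])
  moreover have "w' = w" if w': "w \<subseteq> w'" "w' \<subseteq> L_level i" "consistent w'" for w'
  proof -
    obtain z' where z': "z' \<in> Omega" "w' \<subseteq> z'" using lindenbaum[OF w'(3)] .
    have "g \<in> z" if g: "g \<in> w'" for g
    proof (rule ccontr)
      assume "g \<notin> z"
      then have "Neg g \<in> w" using z g w' Omega_Neg by (auto simp: L_level_def)
      then show False using w' z' g Omega_Neg by blast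
    qed
    then show ?thesis using w' z by blast
  qed
  ultimately show "w \<in> Omega_level i" using z by (auto simp: Omega_level_def)
qed

lemma F_bar_eq:
  assumes "0 < i"
  shows "F_bar i j = (Omega_level i :: ('x, 'j) fm set set) // {(v, w). v \<in> Omega_level i \<and> w \<in> Omega_level i \<and>
    below i (knows j v) = below i (knows j w)}"
proof -
  have "{g \<in> L_level (i - 1). K j g \<in> v} = below i (knows j v)" for v :: "('x, 'j) fm set"
    using assms by (auto simp: below_def knows_def L_level_def)
  then show ?thesis using assms by (simp add: F_bar_def)
qed

lemma F_bar_class:
  assumes "w \<in> Omega_level i"
  shows "{v \<in> Omega_level i. below i (knows j v) = below i (knows j w)} \<in> F_bar i j"
proof (cases "i = 0")
  case True
  then show ?thesis by (simp add: F_bar_def below_def)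
next
  case False
  let ?r = "{(v, w). v \<in> Omega_level i \<and> w \<in> Omega_level i \<and>
    below i (knows j v) = below i (knows j w)}"
  have "{v \<in> Omega_level i. below i (knows j v) = below i (knows j w)} = ?r `` {w}"
    using assms by auto
  then show ?thesis using False quotientI[OF assms, of ?r] by (simp add: F_bar_eq)
qed

lemma F_bar_knows:
  assumes "B \<in> F_bar i j" "v \<in> B" "w \<in> B"
  shows "below i (knows j v) = below i (knows j w)"
proof (cases "i = 0")
  case True
  then show ?thesis by (simp add: below_def)
next
  case False
  then show ?thesis using assms by (auto simp: F_bar_eq elim!: quotientE)
qed

lemma alpha_eq:
  fixes f :: "('x::countable, 'j::countable) fm"
  shows "alpha (depth f) f = below (Suc (depth f)) ` {z \<in> Omega. f \<in> z}"
  by (auto simp: alpha_def Omega_level_eq below_def)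

lemma semantically_closedD:
  "semantically_closed i A \<Longrightarrow> 0 < i \<Longrightarrow> D \<in> F_level i j \<Longrightarrow> B \<in> G_level (i - 1) \<Longrightarrow>
    w \<in> A \<Longrightarrow> pi_preimage i {w} \<subseteq> D \<Longrightarrow> D \<inter> B \<noteq> {} \<Longrightarrow> D \<inter> B \<inter> pi_preimage i A \<noteq> {}"
  by (simp add: semantically_closed_def)

text \<open>Semantic closure supplies \<open>p_witness\<close>: a counterexample \<open>y\<close>
  need not satisfy \<open>f\<close>, but it can be exchanged for a point that contains
  \<open>f\<close>, shares the knowledge of \<open>j\<close> below depth \<open>?d\<close>, and
  agrees with \<open>y\<close> below that depth.\<close>

lemma faithful_semantically_closed:
  fixes f :: "('x::finite, 'j::finite) fm"
  assumes "semantically_closed (depth f) (alpha (depth f) f)"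
  shows "faithful_model {z \<in> Omega. f \<in> z} (\<lambda>j z. below (depth f) (knows j z)) (\<lambda>z. z) (depth f)"
proof
  let ?d = "depth f" and ?W = "{z \<in> Omega. f \<in> z}"
  fix z and g :: "('x, 'j) fm" and j
  assume z: "z \<in> ?W" and g: "depth g < ?d" "K j g \<notin> z"
  obtain y where y: "y \<in> Omega" "knows j y = knows j z" "g \<notin> y"
    using z K_witness[of z j g] g by blast
  let ?w = "below (Suc ?d) z" and ?m = "?d - 1"
  \<comment> \<open>Because \<open>depth g < ?d\<close>, the depth of \<open>f\<close> is positive
    and \<open>?m\<close> is a true predecessor.\<close>
  have d: "Suc ?m = ?d" using g by simp
  have kb: "below ?d (knows j (below (Suc ?d) x)) = below ?d (knows j x)" for x
    by (rule below_knows_cong) (simp add: below_below)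
  define D where "D = pi_preimage ?d
    {v \<in> Omega_level ?d. below ?d (knows j v) = below ?d (knows j ?w)}"
  have wO: "?w \<in> Omega_level ?d" using z by (auto simp: Omega_level_eq)
  have D: "D = {x \<in> Omega. below ?d (knows j x) = below ?d (knows j z)}"
    by (auto simp: D_def pi_preimage_def Int_L_level Omega_level_eq kb)
  have "D \<in> F_level ?d j"
    unfolding D_def F_level_def by (intro imageI F_bar_class[OF wO])
  moreover define B where "B = pi_preimage ?m {below ?d y}"
  have B: "B = {x \<in> Omega. below ?d x = below ?d y}"
    unfolding B_def pi_preimage_def Int_L_level d by blast
  have "below ?d y \<in> Omega_level ?m" using y(1) unfolding Omega_level_eq d by blast
  then have "B \<in> G_level ?m" unfolding B_def G_level_def by (rule imageI)
  moreover have "?w \<in> alpha ?d f" using z by (auto simp: alpha_eq)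
  moreover have "pi_preimage ?d {?w} \<subseteq> D"
    by (auto simp: D pi_preimage_def Int_L_level dest: below_knows_cong)
  moreover have "D \<inter> B \<noteq> {}" using y by (auto simp: D B)
  ultimately have "D \<inter> B \<inter> pi_preimage ?d (alpha ?d f) \<noteq> {}"
    using g(1) by (intro semantically_closedD[OF assms]) auto
  then obtain x where x: "x \<in> D" "x \<in> B" "below (Suc ?d) x \<in> alpha ?d f"
    by (auto simp: pi_preimage_def Int_L_level)
  have "f \<in> x" using x(3) by (simp add: alpha_def below_def)
  moreover have "g \<notin> x" using x(2) y(3) g(1) by (auto simp: B below_def)
  ultimately show "\<exists>t\<in>?W. below ?d (knows j t) = below ?d (knows j z) \<and> g \<notin> t"
    using x(1) by (auto simp: D)
qed simp_all

text \<open>Lifting gives agreement below depth \<open>i\<close> only; absence of branching upgrades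
  it to depth \<open>i\<close>.\<close>

lemma not_branching_lift:
  fixes f :: "('x::finite, 'j::finite) fm"
  assumes nb: "\<not> branching f i j z" and z: "z \<in> Ck_set {f}" and u: "u \<in> Ck_set {f}"
    and eq: "below i (knows j z) = below i (knows j u)"
  obtains y where "y \<in> Omega" "knows j y = knows j z" "below (Suc i) y = below (Suc i) u"
proof -
  obtain y where y: "y \<in> Omega" "knows j y = knows j z" "below i y = below i u"
    using below_lift[OF Ck_set_Omega[OF z] Ck_set_Omega[OF u] eq] .
  have "y \<in> Ck_set {f}" using Ck_set_accessible[OF z y(1,2)] .
  then have "below (Suc i) y = below (Suc i) u"
    using nb u eq y unfolding branching_def by metis
  then show thesis using that y by blast
qed

text \<open>Without branching, agreement up to depth \<open>i\<close> is a bisimulation on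
  \<open>Ck_set {f}\<close>: each alternative of one point is matched by one of the other. Hence it
  preserves formulas of every depth.\<close>

lemma not_branching_determined:
  fixes f :: "('x::finite, 'j::finite) fm"
  assumes nb: "\<And>j z. z \<in> Ck_set {f} \<Longrightarrow> \<not> branching f i j z"
    and "z \<in> Ck_set {f}" "u \<in> Ck_set {f}" "below (Suc i) z = below (Suc i) u"
    and "depth f \<le> i"
  shows "z = u"
proof -
  have "g \<in> z \<longleftrightarrow> g \<in> u" for g
    using assms(2,3,4)
  proof (induction g arbitrary: z u)
    case (Prop x)
    have "Prop x \<in> below (Suc i) z \<longleftrightarrow> Prop x \<in> below (Suc i) u" using Prop by simp
    then show ?case by (simp add: below_def)
  next
    case (Neg g)
    show ?case
      using Neg.IH[OF Neg.prems] Omega_Neg[OF Ck_set_Omega[OF Neg.prems(1)]]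
        Omega_Neg[OF Ck_set_Omega[OF Neg.prems(2)]]
      by simp
  next
    case (Conj g h)
    show ?case
      using Conj.IH(1)[OF Conj.prems] Conj.IH(2)[OF Conj.prems] Omega_Conj[OF Ck_set_Omega[OF Conj.prems(1)]]
        Omega_Conj[OF Ck_set_Omega[OF Conj.prems(2)]]
      by simp
  next
    case (K j g)
    have *: "K j g \<in> b" if a: "a \<in> Ck_set {f}" and b: "b \<in> Ck_set {f}"
      and eq: "below (Suc i) a = below (Suc i) b" and Ka: "K j g \<in> a" for a b
    proof (rule ccontr)
      assume "K j g \<notin> b"
      then obtain y where y: "y \<in> Omega" "knows j y = knows j b" "g \<notin> y"
        using K_witness[OF Ck_set_Omega[OF b]] by metis
      have yS: "y \<in> Ck_set {f}" using Ck_set_accessible[OF b y(1,2)] .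
      have "below i (knows j a) = below i (knows j y)"
        using below_knows_cong[OF eq] y(2) by simp
      then obtain x where x: "x \<in> Omega" "knows j x = knows j a" "below (Suc i) x = below (Suc i) y"
        using not_branching_lift[OF nb[OF a] a yS] by blast
      have "g \<in> x" using x knows_subset[OF x(1)] Ka by (auto simp: knows_def)
      moreover have "x \<in> Ck_set {f}" using Ck_set_accessible[OF a x(1,2)] .
      ultimately show False using K.IH[OF _ yS x(3)] y(3) by blast
    qed
    show ?case using *[OF K.prems] *[OF K.prems(2,1) K.prems(3)[symmetric]] by blast
  qed
  then show ?thesis by blast
qed

lemma generative_branching:
  fixes f :: "('x::finite, 'j::finite) fm"
  assumes "generative f"
  shows "\<exists>j. \<exists>z\<in>Ck_set {f}. branching f (depth f) j z"
proof (rule ccontr)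
  assume "\<not> ?thesis"
  then have nb: "\<not> branching f (depth f) j z" if "z \<in> Ck_set {f}" for j z
    using that by blast
  let ?d = "depth f" and ?A = "alpha (depth f) f"
  obtain C D where CD: "C \<noteq> D" "cell C" "cell D" "C \<subseteq> Ck_set {f}" "D \<subseteq> Ck_set {f}"
    using assms unfolding generative_def dense_in_Ck_def by blast
  have closed: "semantically_closed ?d ?A" and conn: "connected_level ?d ?A"
    using assms unfolding generative_def by blast+
  interpret faithful_model "{z \<in> Omega. f \<in> z}" "\<lambda>j z. below ?d (knows j z)" "\<lambda>z. z" ?d
    by (rule faithful_semantically_closed[OF closed])
  \<comment> \<open>In the model of all points containing \<open>f\<close>, the formula
    \<open>f\<close> is common knowledge, and truncations at its depth are unchanged.\<close>
  have onto: "\<exists>z\<in>Ck_set {f}. below (Suc ?d) z = w" if w: "w \<in> ?A" for w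
  proof -
    obtain z where z: "z \<in> {z \<in> Omega. f \<in> z}" "w = below (Suc ?d) z"
      using w unfolding alpha_eq by blast
    show ?thesis
    proof (rule bexI)
      show "below (Suc ?d) (theory_of {z \<in> Omega. f \<in> z} (\<lambda>j z. below ?d (knows j z)) (\<lambda>z. z) z) = w"
        using below_theory_of[OF z(1)] z(2) by simp
    qed (rule theory_of_in_Ck_set[OF order_refl _ z(1)], simp)
  qed
  have "C \<noteq> {}" "D \<noteq> {}" using CD(2,3) by (simp_all add: cell_def)
  then obtain c e where c: "c \<in> C" and e: "e \<in> D" by blast
  have inA: "below (Suc ?d) z \<in> ?A" if "z \<in> Ck_set {f}" for z
    using Ck_set_Omega[OF that] Ck_set_mem[OF that] unfolding alpha_eq by blast
  have "(below (Suc ?d) c, below (Suc ?d) e) \<in>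
      {(u, v). u \<in> ?A \<and> v \<in> ?A \<and> (\<exists>j. \<exists>B\<in>F_bar ?d j. u \<in> B \<and> v \<in> B)}\<^sup>*"
  proof -
    have "below (Suc ?d) c \<in> ?A" "below (Suc ?d) e \<in> ?A" using inA c e CD by blast+
    then show ?thesis using conn by (simp add: connected_level_def)
  qed
  \<comment> \<open>A point of \<open>C\<close> is carried along the connecting chain: each link is
    followed by passing to an alternative, which stays in the cell.\<close>
  then have "\<exists>y\<in>C. below (Suc ?d) y = below (Suc ?d) e"
  proof (induction rule: rtrancl_induct)
    case base
    then show ?case using c by blast
  next
    case (step u v)
    then obtain y j B where y: "y \<in> C" "below (Suc ?d) y = u"
      and v: "v \<in> ?A" and B: "B \<in> F_bar ?d j" "u \<in> B" "v \<in> B" by blast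
    obtain x where x: "x \<in> Ck_set {f}" "below (Suc ?d) x = v" using onto[OF v] by blast
    have yS: "y \<in> Ck_set {f}" using y CD by blast
    have kb: "below ?d (knows j (below (Suc ?d) a)) = below ?d (knows j a)" for a
      by (rule below_knows_cong) (simp add: below_below)
    have "below ?d (knows j y) = below ?d (knows j x)"
      using F_bar_knows[OF B] unfolding y(2)[symmetric] x(2)[symmetric] kb .
    then obtain y' where y': "y' \<in> Omega" "knows j y' = knows j y"
        "below (Suc ?d) y' = below (Suc ?d) x"
      using not_branching_lift[OF nb[OF yS] yS x(1)] by blast
    then show ?case using cell_accessible[OF CD(2) y(1)] x(2) by blast
  qed
  then obtain y where y: "y \<in> C" "below (Suc ?d) y = below (Suc ?d) e" by blast
  \<comment> \<open>The truncation determines the point, so the two cells would meet.\<close>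
  have "y = e"
  proof (rule not_branching_determined[OF nb])
    show "y \<in> Ck_set {f}" "e \<in> Ck_set {f}" using y(1) e CD by blast+
  qed (simp_all add: y(2))
  then show False using cells_meet_eq[OF CD(2,3)] CD(1) y(1) e by blast
qed

theorem corollary1:
  fixes f :: "('x::finite, 'j::finite) fm"
    and C :: "('x, 'j) fm set set"
  assumes "generative f"
    and "cell C"
    and "finite_fanout C"
    and "F C = Ck_fms {f}"
  shows "\<not> (\<exists>n::nat. \<forall>P. possibility_set P \<and> P \<subseteq> C \<longrightarrow> finite P \<and> card P \<le> n)"
proof
  assume "\<exists>n::nat. \<forall>P. possibility_set P \<and> P \<subseteq> C \<longrightarrow> finite P \<and> card P \<le> n"
  then obtain n where n: "\<And>P. possibility_set P \<Longrightarrow> P \<subseteq> C \<Longrightarrow> finite P \<and> card P \<le> n"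
    by blast
  have possibility_bound: "finite {y \<in> Omega. knows j y = knows j z} \<and>
      card {y \<in> Omega. knows j y = knows j z} \<le> n" if "z \<in> Ck_set {f}" for j z
    using n by (rule possibility_bound_transfer[OF assms(2,4) _ that])
  note bound = level_class_bound[of f n, OF possibility_bound]
  obtain j z where z: "z \<in> Ck_set {f}" "branching f (depth f) j z"
    using generative_branching[OF assms(1)] by blast
  have "\<exists>k. k \<noteq> j"
  proof (rule ccontr)
    assume "\<nexists>k. k \<noteq> j"
    then have "(UNIV :: 'j set) = {j}" by auto
    then have "CARD('j) = 1" by (metis card_1_singleton_iff One_nat_def)
    then show False using assms(1) by (simp add: generative_def)
  qed
  then obtain k where "k \<noteq> j" ..
  \<comment> \<open>Two level classes of at most \<open>n\<close> elements each cannot have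
    cardinalities summing to \<open>Suc (2 * n)\<close>.\<close>
  from branching_unbounded[OF _ z this, of "Suc (2 * n)"] bound
  obtain i z j k where i: "depth f \<le> i" and z: "z \<in> Ck_set {f}"
    and sum: "Suc (2 * n) \<le> card (level_class f i j z) + card (level_class f i k z)" by blast
  have "card (level_class f i j z) \<le> n" "card (level_class f i k z) \<le> n"
    using bound[OF _ i z] by blast+
  with sum show False by linarith
qed

end
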